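(* Let $A\in\mathbb{R}^{m\times n}$ be nonzero, let $Ax=b$ be a consistent linear system, let $x^0\in\mathbb{R}^n$, and let $x^*$ be the solution of $Ax=b$ closest to $x^0$ in Euclidean norm. Let $\{x^k\}_{k\ge0}$ be the iterates of the randomized block Kaczmarz method, $$x^{k+1}=x^k-(A_{\mathcal J,:})^\dagger(A_{\mathcal J,:}x^k-b_{\mathcal J}),$$ where the block $\mathcal J=\{j_1,\dots,j_\ell\}$ in each iteration consists of $\ell\ge1$ rows of $A$ independently sampled from the distribution $\{\|A_{j,:}\|_2^2/\|A\|_F^2\}_{j=1}^m$ (independently across iterations). If $\sigma_{\min}^+(A)$ denotes the smallest non-zero singular value of $A$, then for all $k\ge0$ $$\mathbb{E}\|x^k-x^*\|_2^2\le\left(1-\frac{\sigma_{\min}^+(A)^2}{\|A\|_F^2}\right)^{\ell k}\|x^0-x^*\|_2^2.$$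
   Context: $A_{\mathcal J,:}$ is the row submatrix of $A$ indexed by $\mathcal J$, $b_{\mathcal J}$ the corresponding subvector, $M^\dagger$ the Moore–Penrose pseudoinverse, $\|\cdot\|_F$ the Frobenius norm. Sampling is with replacement, so indices may repeat within a block. *)

theory Defs
  imports "HOL-Probability.Probability"
begin

definition frobenius_norm :: "real^'n^'m \<Rightarrow> real" where
  "frobenius_norm A = sqrt (\<Sum>i\<in>UNIV. \<Sum>j\<in>UNIV. (A $ i $ j)\<^sup>2)"

(* The four Penrose equations; for every real matrix they have exactly one solution. *)
definition pseudoinverse :: "real^'n^'m \<Rightarrow> real^'m^'n" where
  "pseudoinverse A = (THE X.
     A ** X ** A = A \<and>
     X ** A ** X = X \<and>
     transpose (A ** X) = A ** X \<and>
     transpose (X ** A) = X ** A)"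

(* Square roots of the eigenvalues of A^T A. Whether 0 counts as a singular value of a
   rectangular matrix depends on convention (A^T A or A A^T), the non-zero ones do not. *)
definition singular_value :: "real^'n^'m \<Rightarrow> real \<Rightarrow> bool" where
  "singular_value A s \<longleftrightarrow>
     0 \<le> s \<and> (\<exists>v. v \<noteq> 0 \<and> (transpose A ** A) *v v = s\<^sup>2 *\<^sub>R v)"

(* The set is finite, and it is non-empty when A is non-zero. *)
definition sigma_min_pos :: "real^'n^'m \<Rightarrow> real" where
  "sigma_min_pos A = Min {s. singular_value A s \<and> s \<noteq> 0}"

(* A block of l = CARD('l) row indices is a family J :: 'l \<Rightarrow> 'm, not a set, so that an
   index may occur several times; the corresponding row is then repeated. *)
definition row_submatrix :: "real^'n^'m \<Rightarrow> ('l \<Rightarrow> 'm) \<Rightarrow> real^'n^'l" where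
  "row_submatrix A J = (\<chi> i. row (J i) A)"

definition subvector :: "real^'m \<Rightarrow> ('l \<Rightarrow> 'm) \<Rightarrow> real^'l" where
  "subvector b J = (\<chi> i. b $ J i)"

(* J k is the block used in the step from iterate k to iterate k + 1. *)
primrec block_kaczmarz ::
  "real^'n^'m \<Rightarrow> real^'m \<Rightarrow> real^'n \<Rightarrow> (nat \<Rightarrow> 'l::finite \<Rightarrow> 'm) \<Rightarrow> nat \<Rightarrow> real^'n" where
  "block_kaczmarz A b x0 J 0 = x0"
| "block_kaczmarz A b x0 J (Suc k) =
     block_kaczmarz A b x0 J k -
     pseudoinverse (row_submatrix A (J k)) *v
       (row_submatrix A (J k) *v block_kaczmarz A b x0 J k - subvector b (J k))"

end

theory Submission
  imports Defs
begin

text \<open>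
  Let \<open>e = x\<^sup>k - x\<^sup>*\<close> be the error before a step with block \<open>J\<close>. Since \<open>b = A x\<^sup>*\<close>,
  one step maps \<open>e\<close> to \<open>e - B\<^sup>\<dagger> B e\<close> with \<open>B = A\<^bsub>J,:\<^esub>\<close>, and \<open>B\<^sup>\<dagger> B\<close> is the orthogonal
  projection onto the span of the sampled rows. The new error is therefore the component of
  \<open>e\<close> orthogonal to these rows.

  The key comparison is with the classical Kaczmarz method: projecting \<open>e\<close> successively onto
  the hyperplanes orthogonal to the rows \<open>j\<^sub>1, ..., j\<^sub>l\<close> only subtracts combinations of these
  rows, so the result still has the component above, and hence is at least as long
  (\<open>norm_block_project_le_fold\<close>). A block of size \<open>l\<close> is thus at least as good as \<open>l\<close>
  single-row steps started at the same \<open>e\<close>.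

  A single random row \<open>j\<close>, drawn with probability proportional to its squared norm, removes on
  average \<open>\<Sum>\<^sub>j (a\<^sub>j \<bullet> v)\<^sup>2 / F\<^sup>2 = |A v|\<^sup>2 / F\<^sup>2\<close> from \<open>|v|\<^sup>2\<close>, where \<open>F\<close> is the Frobenius norm. On the
  orthogonal complement of the kernel of \<open>A\<close> this is at least
  \<open>\<sigma>\<^sup>2 |v|\<^sup>2 / F\<^sup>2\<close> with \<open>\<sigma>\<close> the least positive singular value
  (\<open>expected_row_project_le\<close>). The initial error lies in this complement because \<open>x\<^sup>*\<close> is the
  solution closest to the starting point, and all the projections preserve the complement.

  Finally, an error that depends on finitely many of the sampled indices is independent of any
  further index, so each single-row step multiplies the expected squared error by at most
  \<open>1 - \<sigma>\<^sup>2 / F\<^sup>2\<close> (\<open>expected_fold_row_project_le\<close>). Each block contributes \<open>l\<close> such factors.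
\<close>

section \<open>The Moore--Penrose pseudoinverse\<close>

text \<open>
  Two solutions give the same product \<open>A X = A Y\<close>: both are orthogonal projections onto the
  range of \<open>A\<close>, and transposing \<open>(A Y) (A X) = A X\<close> swaps the factors. The same holds for
  \<open>X A = Y A\<close>, so \<open>X = X A X = Y A Y = Y\<close>.
\<close>
lemma penrose_equations_unique:
  fixes A :: "real^'n^'m" and X Y :: "real^'m^'n"
  assumes X: "A ** X ** A = A" "X ** A ** X = X"
      "transpose (A ** X) = A ** X" "transpose (X ** A) = X ** A"
    and Y: "A ** Y ** A = A" "Y ** A ** Y = Y"
      "transpose (A ** Y) = A ** Y" "transpose (Y ** A) = Y ** A"
  shows "X = Y"
proof -
  have AX: "A ** X = A ** Y"
  proof -
    have "A ** X = transpose ((A ** Y) ** (A ** X))"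
      by (metis X(3) Y(1) matrix_mul_assoc)
    also have "\<dots> = (A ** X) ** (A ** Y)"
      by (simp only: matrix_transpose_mul[of "A ** Y" "A ** X"] X(3) Y(3))
    also have "\<dots> = A ** Y"
      by (metis X(1) matrix_mul_assoc)
    finally show ?thesis .
  qed
  have XA: "X ** A = Y ** A"
  proof -
    have "X ** A = transpose ((X ** A) ** (Y ** A))"
      by (metis X(4) Y(1) matrix_mul_assoc)
    also have "\<dots> = (Y ** A) ** (X ** A)"
      by (simp only: matrix_transpose_mul[of "X ** A" "Y ** A"] X(4) Y(4))
    also have "\<dots> = Y ** A"
      by (metis X(1) matrix_mul_assoc)
    finally show ?thesis .
  qed
  show "X = Y"
    by (metis AX XA X(2) Y(2) matrix_mul_assoc)
qed

lemma orthogonal_projection_exists: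
  fixes S :: "'a::euclidean_space set"
  assumes "subspace S"
  obtains P where "linear P" "\<And>x. P x \<in> S" "\<And>x. x \<in> S \<Longrightarrow> P x = x"
    "\<And>x y. P x \<bullet> y = x \<bullet> P y"
proof -
  obtain B where B: "B \<subseteq> S" "pairwise orthogonal B" "\<And>x. x \<in> B \<Longrightarrow> norm x = 1"
      "independent B" "span B = S"
    using orthonormal_basis_subspace[OF assms] by metis
  have fin: "finite B"
    using B(4) independent_imp_finite by blast
  define P where "P x = (\<Sum>u\<in>B. (x \<bullet> u) *\<^sub>R u)" for x
  have lin: "linear P"
    by (rule linearI)
      (simp_all add: P_def inner_add_left scaleR_add_left sum.distrib scaleR_sum_right)
  have basis: "P v = v" if "v \<in> B" for v
  proof -
    have "P v = (\<Sum>u\<in>B. if u = v then v else 0)"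
      unfolding P_def
    proof (rule sum.cong[OF refl])
      fix u assume "u \<in> B"
      show "(v \<bullet> u) *\<^sub>R u = (if u = v then v else 0)"
        using B(2,3) \<open>u \<in> B\<close> that
        by (auto simp: pairwise_def orthogonal_def norm_eq_1)
    qed
    with fin that show ?thesis by simp
  qed
  have fixed: "P x = x" if "x \<in> S" for x
  proof (rule linear_eq_on[of P "\<lambda>x. x" x B])
    show "x \<in> span B" using that B(5) by simp
  qed (use lin basis in \<open>auto simp: linear_iff\<close>)
  show thesis
  proof (rule that[OF lin _ fixed])
    show "P x \<in> S" for x
      unfolding P_def using B(1) assms by (intro subspace_sum subspace_scale) auto
    show "P x \<bullet> y = x \<bullet> P y" for x y
      by (simp add: P_def inner_sum_left inner_sum_right mult.commute inner_commute)
  qed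
qed

lemma transpose_matrix_selfadjoint:
  fixes f :: "real^'n \<Rightarrow> real^'n"
  assumes "\<And>x y. f x \<bullet> y = x \<bullet> f y"
  shows "transpose (matrix f) = matrix f"
proof -
  have "f (axis i 1) $ j = f (axis j 1) $ i" for i j
    using assms[of "axis i 1" "axis j 1"] by (simp add: inner_axis inner_axis')
  then show ?thesis
    by (simp add: matrix_def transpose_def vec_eq_iff)
qed

lemma inner_matrix_vector_mult_transpose:
  fixes A :: "real^'n^'m"
  shows "(A *v x) \<bullet> y = x \<bullet> (transpose A *v y)"
  by (metis dot_lmul_matrix inner_commute transpose_matrix_vector)

text \<open>
  The matrix \<open>A\<close> restricts to a bijection from the range \<open>V\<close> of its transpose onto its own
  range \<open>R\<close>. The pseudoinverse is the orthogonal projection onto \<open>R\<close> followed by the inverse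
  of this bijection; then \<open>A X\<close> and \<open>X A\<close> are the orthogonal projections onto \<open>R\<close> and \<open>V\<close>.
\<close>
lemma penrose_equations_exist:
  fixes A :: "real^'n^'m"
  shows "\<exists>X :: real^'m^'n. A ** X ** A = A \<and> X ** A ** X = X \<and>
     transpose (A ** X) = A ** X \<and> transpose (X ** A) = X ** A"
proof -
  define R where "R = range (\<lambda>x. A *v x)"
  define V where "V = range (\<lambda>y. transpose A *v y)"
  have "subspace R" "subspace V"
    unfolding R_def V_def by (intro linear_subspace_image matrix_vector_mul_linear subspace_UNIV)+
  obtain P where P: "linear P" "\<And>x. P x \<in> R" "\<And>x. x \<in> R \<Longrightarrow> P x = x"
      "\<And>x y. P x \<bullet> y = x \<bullet> P y"
    using orthogonal_projection_exists[OF \<open>subspace R\<close>] by blast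
  obtain Q where Q: "linear Q" "\<And>x. Q x \<in> V" "\<And>x. x \<in> V \<Longrightarrow> Q x = x"
      "\<And>x y. Q x \<bullet> y = x \<bullet> Q y"
    using orthogonal_projection_exists[OF \<open>subspace V\<close>] by blast
  have AQ: "A *v Q x = A *v x" for x
  proof -
    have "(A *v (x - Q x)) \<bullet> y = 0" for y
    proof -
      have "transpose A *v y \<in> V" unfolding V_def by blast
      then have "x \<bullet> (transpose A *v y) = Q x \<bullet> (transpose A *v y)"
        using Q(3)[of "transpose A *v y"] Q(4)[of x "transpose A *v y"]
        by (simp del: transpose_matrix_vector)
      then show ?thesis
        by (simp add: inner_matrix_vector_mult_transpose inner_diff_left del: transpose_matrix_vector)
    qed
    then have "A *v (x - Q x) = 0"
      using inner_eq_zero_iff by blast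
    then show ?thesis
      by (simp add: matrix_vector_mult_diff_distrib)
  qed
  have inj: "inj_on (\<lambda>x. A *v x) V"
  proof (rule inj_onI)
    fix x y assume xy: "x \<in> V" "y \<in> V" "A *v x = A *v y"
    then have d: "x - y \<in> V" "A *v (x - y) = 0"
      using \<open>subspace V\<close> by (auto simp: subspace_diff matrix_vector_mult_diff_distrib)
    then obtain z where "x - y = transpose A *v z" unfolding V_def by blast
    then have "(x - y) \<bullet> (x - y) = (A *v (x - y)) \<bullet> z"
      by (simp only: inner_matrix_vector_mult_transpose)
    then have "(x - y) \<bullet> (x - y) = 0"
      using d(2) by simp
    then show "x = y" by simp
  qed
  obtain g where g: "linear g" "\<And>v. v \<in> V \<Longrightarrow> g (A *v v) = v"
    using linear_exists_left_inverse_on[OF matrix_vector_mul_linear \<open>subspace V\<close> inj] by blast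
  define X where "X = matrix (g \<circ> P)"
  have X: "X *v y = g (P y)" for y
    unfolding X_def using linear_compose[OF P(1) g(1)] by (simp add: matrix_works)
  have gA: "g (A *v x) = Q x" for x
    using g(2)[OF Q(2)[of x]] AQ by simp
  have AX: "A *v (X *v y) = P y" for y
  proof -
    obtain x where x: "P y = A *v x" using P(2)[of y] R_def by auto
    then show ?thesis by (simp add: X gA AQ)
  qed
  have XA: "X *v (A *v x) = Q x" for x
    by (simp add: X P(3) R_def gA)
  have "A ** X = matrix P" "X ** A = matrix Q"
    by (simp_all add: matrix_eq matrix_works P(1) Q(1) AX XA flip: matrix_vector_mul_assoc)
  then have "transpose (A ** X) = A ** X" "transpose (X ** A) = X ** A"
    using transpose_matrix_selfadjoint[OF P(4)] transpose_matrix_selfadjoint[OF Q(4)] by simp_all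
  moreover have "A ** X ** A = A"
    by (simp add: matrix_eq XA AQ flip: matrix_vector_mul_assoc)
  moreover have "X ** A ** X = X"
    by (simp add: matrix_eq AX flip: matrix_vector_mul_assoc) (simp add: X P(2,3))
  ultimately show ?thesis by blast
qed

text \<open>
  The definite description in the definition denotes, by existence and uniqueness. Two
  consequences make \<open>1 - B\<^sup>\<dagger> B\<close> the orthogonal projection onto the kernel of \<open>B\<close>: it is
  symmetric, and \<open>B\<close> vanishes on its range.
\<close>
lemma pseudoinverse_penrose:
  fixes A :: "real^'n^'m"
  shows "A ** pseudoinverse A ** A = A \<and>
    pseudoinverse A ** A ** pseudoinverse A = pseudoinverse A \<and>
    transpose (A ** pseudoinverse A) = A ** pseudoinverse A \<and>
    transpose (pseudoinverse A ** A) = pseudoinverse A ** A"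
  unfolding pseudoinverse_def
proof (rule theI', rule ex_ex1I[OF penrose_equations_exist])
  fix X Y :: "real^'m^'n"
  assume "A ** X ** A = A \<and> X ** A ** X = X \<and>
      transpose (A ** X) = A ** X \<and> transpose (X ** A) = X ** A"
    and "A ** Y ** A = A \<and> Y ** A ** Y = Y \<and>
      transpose (A ** Y) = A ** Y \<and> transpose (Y ** A) = Y ** A"
  then show "X = Y"
    by (elim conjE) (rule penrose_equations_unique)
qed

lemmas pseudoinverse_inner = pseudoinverse_penrose[THEN conjunct1]
  and pseudoinverse_symmetric =
    pseudoinverse_penrose[THEN conjunct2, THEN conjunct2, THEN conjunct2]

section \<open>Projections of the error\<close>

text \<open>
  The step of the classical Kaczmarz method, acting on the error. For a zero row the division
  by zero yields the identity map.
\<close>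
definition row_project :: "real^'n^'m \<Rightarrow> 'm \<Rightarrow> real^'n \<Rightarrow> real^'n" where
  "row_project A j v = v - ((row j A \<bullet> v) / (norm (row j A))\<^sup>2) *\<^sub>R row j A"

text \<open>
  Described as the orthogonal complement of the kernel, which is the form in which the closest
  solution and the projections interact with it.
\<close>
definition row_space :: "real^'n^'m \<Rightarrow> (real^'n) set" where
  "row_space A = {v. \<forall>w. A *v w = 0 \<longrightarrow> v \<bullet> w = 0}"

lemma subspace_row_space: "subspace (row_space A)"
  by (auto simp: row_space_def subspace_def inner_add_left)

lemma matrix_vector_mult_nth: "(A *v x) $ j = row j A \<bullet> (x :: real^'n)"
  by (simp add: matrix_vector_mult_def row_def inner_vec_def)

lemma row_in_row_space: "row j A \<in> row_space (A :: real^'n^'m)"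
  by (auto simp: row_space_def simp flip: matrix_vector_mult_nth)

lemma row_project_in_row_space:
  "v \<in> row_space A \<Longrightarrow> row_project A j v \<in> row_space A"
  unfolding row_project_def
  using row_in_row_space subspace_row_space subspace_diff subspace_scale by blast

lemma norm_row_project:
  "(norm (row_project A j v))\<^sup>2 = (norm v)\<^sup>2 - (row j A \<bullet> v)\<^sup>2 / (norm (row j A))\<^sup>2"
proof (cases "row j A = 0")
  case False
  then show ?thesis
    unfolding row_project_def power2_norm_eq_inner
    by (simp add: inner_diff_left inner_diff_right inner_commute field_simps power2_eq_square)
qed (simp add: row_project_def)

lemma row_submatrix_kernel: "A *v w = 0 \<Longrightarrow> row_submatrix A J *v w = 0"
  unfolding vec_eq_iff
  by (simp add: row_submatrix_def row_def matrix_vector_mult_def)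

lemma subvector_matrix_vector_mult: "subvector (A *v x) J = row_submatrix A J *v x"
  by (simp add: subvector_def vec_eq_iff row_submatrix_def row_def matrix_vector_mult_def)

definition block_project :: "real^'n^'m \<Rightarrow> ('l::finite \<Rightarrow> 'm) \<Rightarrow> real^'n \<Rightarrow> real^'n" where
  "block_project A J e =
     e - pseudoinverse (row_submatrix A J) *v (row_submatrix A J *v e)"

lemma block_kaczmarz_error_Suc:
  assumes "A *v xs = b"
  shows "block_kaczmarz A b x0 J (Suc k) - xs =
    block_project A (J k) (block_kaczmarz A b x0 J k - xs)"
  by (simp add: block_project_def matrix_vector_mult_diff_distrib
      flip: assms subvector_matrix_vector_mult)

lemma pseudoinverse_projection_selfadjoint:
  "(pseudoinverse B *v (B *v x)) \<bullet> y = x \<bullet> (pseudoinverse B *v (B *v y))"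
  using inner_matrix_vector_mult_transpose[of "pseudoinverse B ** B" x y]
  by (simp add: pseudoinverse_symmetric matrix_vector_mul_assoc del: transpose_matrix_vector)

lemma row_submatrix_block_project: "row_submatrix A J *v block_project A J e = 0"
  by (simp add: block_project_def matrix_vector_mult_diff_distrib matrix_vector_mul_assoc
      matrix_mul_assoc pseudoinverse_inner)

lemma row_orthogonal_block_project: "row (J i) A \<bullet> block_project A J e = 0"
proof -
  have "(row_submatrix A J *v block_project A J e) $ i = 0"
    by (simp add: row_submatrix_block_project)
  then show ?thesis
    by (simp add: matrix_vector_mult_def row_submatrix_def row_def inner_vec_def)
qed

lemma block_project_in_row_space:
  assumes "e \<in> row_space A"
  shows "block_project A J e \<in> row_space A"
  using assms
  by (auto simp: row_space_def block_project_def inner_diff_left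
      pseudoinverse_projection_selfadjoint row_submatrix_kernel)

text \<open>
  Let \<open>d\<close> be the error after the block step. It is orthogonal to every row of the block, so the
  inner product with \<open>d\<close> does not change in a single-row step and equals
  \<open>d \<bullet> e = |d|\<^sup>2\<close> throughout. The claim follows by the Cauchy--Schwarz inequality. The list may
  visit the rows of the block in any order, with repetitions or omissions.
\<close>
lemma norm_block_project_le_fold:
  "norm (block_project A J e) \<le> norm (fold (\<lambda>i. row_project A (J i)) js e)"
proof -
  let ?d = "block_project A J e"
  have fold: "?d \<bullet> fold (\<lambda>i. row_project A (J i)) js v = ?d \<bullet> v" for v
    by (induction js arbitrary: v)
      (simp_all add: row_project_def inner_diff_right inner_commute row_orthogonal_block_project)
  have "?d \<bullet> (pseudoinverse (row_submatrix A J) *v (row_submatrix A J *v e)) = 0"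
    by (simp add: row_submatrix_block_project flip: pseudoinverse_projection_selfadjoint)
  then have "?d \<bullet> e = ?d \<bullet> ?d"
    by (subst (3) block_project_def) (simp add: inner_diff_right)
  then have "(norm ?d)\<^sup>2 = ?d \<bullet> fold (\<lambda>i. row_project A (J i)) js e"
    by (simp add: power2_norm_eq_inner fold)
  also have "\<dots> \<le> norm ?d * norm (fold (\<lambda>i. row_project A (J i)) js e)"
    by (rule norm_cauchy_schwarz)
  finally show ?thesis
    by (cases "?d = 0") (simp_all add: power2_eq_square)
qed

section \<open>Least positive singular value and a single random row\<close>

text \<open>
  Eigenvectors of the symmetric matrix \<open>A\<^sup>T A\<close> for distinct eigenvalues are orthogonal, hence
  linearly independent. Finiteness is what makes the minimum of the positive singular values
  meaningful.
\<close>
lemma finite_singular_values: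
  fixes A :: "real^'n^'m"
  shows "finite {s. singular_value A s}"
proof -
  let ?N = "transpose A ** A" and ?S = "{s. singular_value A s}"
  have "\<forall>s\<in>?S. \<exists>v. v \<noteq> 0 \<and> ?N *v v = s\<^sup>2 *\<^sub>R v"
    by (auto simp: singular_value_def)
  then obtain v where v: "\<And>s. s \<in> ?S \<Longrightarrow> v s \<noteq> 0 \<and> ?N *v v s = s\<^sup>2 *\<^sub>R v s"
    by (metis (no_types, lifting))
  have orth: "v s \<bullet> v t = 0" if "s \<in> ?S" "t \<in> ?S" "s \<noteq> t" for s t
  proof -
    have "(?N *v v s) \<bullet> v t = v s \<bullet> (?N *v v t)"
      by (metis inner_matrix_vector_mult_transpose matrix_transpose_mul transpose_transpose)
    then have "(s\<^sup>2 - t\<^sup>2) * (v s \<bullet> v t) = 0"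
      using v[OF that(1)] v[OF that(2)] by (simp add: algebra_simps)
    moreover have "s\<^sup>2 \<noteq> t\<^sup>2"
      using that by (auto simp: singular_value_def power2_eq_iff_nonneg)
    ultimately show ?thesis by simp
  qed
  have "inj_on v ?S"
    using orth v by (metis inj_onI inner_eq_zero_iff)
  moreover have "finite (v ` ?S)"
  proof (intro independent_imp_finite pairwise_orthogonal_independent)
    show "pairwise orthogonal (v ` ?S)"
      using orth by (force simp: pairwise_def orthogonal_def)
    show "0 \<notin> v ` ?S" using v by force
  qed
  ultimately show ?thesis using finite_imageD by blast
qed

lemma row_space_kernel_trivial:
  "v \<in> row_space A \<Longrightarrow> A *v v = 0 \<Longrightarrow> v = 0"
  by (auto simp: row_space_def)

lemma transpose_mult_in_row_space:
  "transpose A *v y \<in> row_space (A :: real^'n^'m)"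
  by (auto simp: row_space_def inner_commute simp flip: inner_matrix_vector_mult_transpose
    simp del: transpose_matrix_vector)

lemma row_space_nontrivial:
  fixes A :: "real^'n^'m"
  assumes "A \<noteq> 0"
  obtains v where "v \<in> row_space A" "norm v = 1"
proof -
  obtain j where j: "row j A \<noteq> 0"
    using assms by (force simp: row_def vec_eq_iff)
  show thesis
  proof
    show "(1 / norm (row j A)) *\<^sub>R row j A \<in> row_space A"
      using row_in_row_space subspace_row_space subspace_scale by blast
    show "norm ((1 / norm (row j A)) *\<^sub>R row j A) = 1" using j by simp
  qed
qed

text \<open>
  A direct variational argument in place of a spectral decomposition: \<open>|A v|\<close> attains a minimum
  \<open>s\<close> on the unit sphere of the row space, at \<open>u\<close> say. The first-order condition at \<open>u\<close>
  says that \<open>A\<^sup>T A u - s\<^sup>2 u\<close> is orthogonal to the row space. As it also lies in the row space,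
  it is zero.
\<close>
lemma rayleigh_minimum:
  fixes A :: "real^'n^'m"
  assumes "A \<noteq> 0"
  obtains s where "singular_value A s" "s > 0"
    "\<And>v. v \<in> row_space A \<Longrightarrow> s * norm v \<le> norm (A *v v)"
proof -
  let ?V = "row_space A"
  let ?K = "?V \<inter> sphere 0 1"
  have "compact ?K"
    by (intro closed_Int_compact closed_subspace subspace_row_space compact_sphere)
  moreover have "?K \<noteq> {}"
    using row_space_nontrivial[OF assms] by (metis IntI empty_iff mem_sphere_0)
  moreover have "continuous_on ?K (\<lambda>v. norm (A *v v))"
    by (intro continuous_intros linear_continuous_on linear_conv_bounded_linear[THEN iffD1]
        matrix_vector_mul_linear)
  ultimately obtain u where u: "u \<in> ?V" "norm u = 1"
      and min: "\<And>v. v \<in> ?V \<Longrightarrow> norm v = 1 \<Longrightarrow> norm (A *v u) \<le> norm (A *v v)"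
    by (metis (no_types, lifting) IntE IntI continuous_attains_inf mem_sphere_0)
  define s where "s = norm (A *v u)"
  have "s > 0"
    using u row_space_kernel_trivial[of u A] by (auto simp: s_def)
  have bound: "s * norm v \<le> norm (A *v v)" if "v \<in> ?V" for v
  proof (cases "v = 0")
    case False
    have "s \<le> norm (A *v ((1 / norm v) *\<^sub>R v))"
      unfolding s_def using False that by (intro min subspace_scale subspace_row_space) auto
    also have "\<dots> = norm (A *v v) / norm v"
      by (simp add: matrix_vector_mult_scaleR divide_inverse_commute)
    finally show ?thesis using False by (simp add: field_simps)
  qed simp
  have crit: "(A *v u) \<bullet> (A *v w) = s\<^sup>2 * (u \<bullet> w)" if w: "w \<in> ?V" for w
  proof -
    define p where "p = (A *v u) \<bullet> (A *v w) - s\<^sup>2 * (u \<bullet> w)"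
    define q where "q = (norm (A *v w))\<^sup>2 - s\<^sup>2 * (norm w)\<^sup>2"
    have pos: "0 \<le> 2 * t * p + t\<^sup>2 * q" for t :: real
    proof -
      have "u + t *\<^sub>R w \<in> ?V"
        using u w subspace_row_space by (auto intro: subspace_add subspace_scale)
      then have "(s * norm (u + t *\<^sub>R w))\<^sup>2 \<le> (norm (A *v (u + t *\<^sub>R w)))\<^sup>2"
        using \<open>s > 0\<close> by (intro power_mono bound) auto
      moreover have "(norm (A *v (u + t *\<^sub>R w)))\<^sup>2 =
          s\<^sup>2 + 2 * t * ((A *v u) \<bullet> (A *v w)) + t\<^sup>2 * (norm (A *v w))\<^sup>2"
        unfolding s_def power2_norm_eq_inner
        by (simp add: matrix_vector_right_distrib matrix_vector_mult_scaleR inner_add_left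
            inner_add_right inner_commute power2_eq_square algebra_simps)
      moreover have "(norm (u + t *\<^sub>R w))\<^sup>2 = 1 + 2 * t * (u \<bullet> w) + t\<^sup>2 * (norm w)\<^sup>2"
        using u(2) unfolding power2_norm_eq_inner norm_eq_1
        by (simp add: inner_add_left inner_add_right inner_commute power2_eq_square algebra_simps)
      ultimately show ?thesis
        by (simp add: p_def q_def power_mult_distrib algebra_simps)
    qed
    \<comment> \<open>A function of the form \<open>2 t p + t\<^sup>2 q\<close> with slope \<open>2 p \<noteq> 0\<close> at the origin is negative for a
      small \<open>t\<close> of sign opposite to \<open>p\<close>; \<open>t = - p / c\<close> is small enough if \<open>c > q / 2\<close>.\<close>
    have "p = 0"
    proof (rule ccontr)
      assume "p \<noteq> 0"
      define c where "c = \<bar>q\<bar> + 1"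
      have "c > 0" "q < c" by (auto simp: c_def)
      have "0 \<le> 2 * (- p / c) * p + (- p / c)\<^sup>2 * q" by (rule pos)
      also have "\<dots> = (p\<^sup>2 / c\<^sup>2) * (q - 2 * c)"
        using \<open>c > 0\<close> by (simp add: field_simps power2_eq_square)
      also have "\<dots> < 0"
        using \<open>c > 0\<close> \<open>q < c\<close> \<open>p \<noteq> 0\<close> by (intro mult_pos_neg) auto
      finally show False by simp
    qed
    then show ?thesis by (simp add: p_def)
  qed
  let ?r = "(transpose A ** A) *v u - s\<^sup>2 *\<^sub>R u"
  have "?r \<in> ?V"
    unfolding matrix_vector_mul_assoc[symmetric]
    using u subspace_row_space transpose_mult_in_row_space by (intro subspace_diff subspace_scale)
  have "?r \<bullet> ?r = ?r \<bullet> ((transpose A ** A) *v u) - s\<^sup>2 * (?r \<bullet> u)"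
    by (simp only: inner_diff_right inner_scaleR_right)
  also have "?r \<bullet> ((transpose A ** A) *v u) = (A *v ?r) \<bullet> (A *v u)"
    by (simp only: inner_matrix_vector_mult_transpose[of A ?r] matrix_vector_mul_assoc)
  also have "(A *v ?r) \<bullet> (A *v u) - s\<^sup>2 * (?r \<bullet> u) = 0"
    using crit[OF \<open>?r \<in> ?V\<close>] by (simp only: inner_commute)
  finally have "(transpose A ** A) *v u = s\<^sup>2 *\<^sub>R u" by simp
  moreover have "u \<noteq> 0" using u(2) by auto
  ultimately have "singular_value A s"
    using \<open>s > 0\<close> unfolding singular_value_def by (metis less_imp_le)
  then show thesis using that \<open>s > 0\<close> bound by blast
qed

lemma sigma_min_pos_bound:
  fixes A :: "real^'n^'m"
  assumes "A \<noteq> 0" "v \<in> row_space A"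
  shows "(sigma_min_pos A)\<^sup>2 * (norm v)\<^sup>2 \<le> (norm (A *v v))\<^sup>2"
proof -
  obtain s where s: "singular_value A s" "s > 0" "s * norm v \<le> norm (A *v v)"
    using rayleigh_minimum[OF assms(1)] assms(2) by metis
  let ?S = "{s. singular_value A s \<and> s \<noteq> 0}"
  have fin: "finite ?S" by (rule finite_subset[OF _ finite_singular_values[of A]]) auto
  have "s \<in> ?S" using s by simp
  then have "sigma_min_pos A \<in> ?S" "sigma_min_pos A \<le> s"
    unfolding sigma_min_pos_def using fin by (metis Min_in empty_iff, simp)
  then have "0 \<le> sigma_min_pos A" "sigma_min_pos A \<le> s" by (auto simp: singular_value_def)
  then have "sigma_min_pos A * norm v \<le> norm (A *v v)"
    using s(3) by (meson mult_right_mono norm_ge_zero order_trans)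
  then show ?thesis
    using \<open>0 \<le> sigma_min_pos A\<close> by (simp add: power_mono flip: power_mult_distrib)
qed

lemma frobenius_norm_rows: "(frobenius_norm A)\<^sup>2 = (\<Sum>j\<in>UNIV. (norm (row j A))\<^sup>2)"
  by (simp add: frobenius_norm_def sum_nonneg real_sqrt_pow2 power2_norm_eq_inner inner_vec_def row_def
      flip: power2_eq_square)

lemma frobenius_norm_pos: "A \<noteq> 0 \<Longrightarrow> 0 < (frobenius_norm A)\<^sup>2"
proof -
  assume "A \<noteq> 0"
  then obtain j where "row j A \<noteq> 0"
    by (force simp: row_def vec_eq_iff)
  then show ?thesis
    unfolding frobenius_norm_rows by (intro sum_pos2[of _ j]) auto
qed

text \<open>
  The squared row norm in the sampling probability cancels the one in the denominator of the
  projection, which leaves the sum of \<open>(A v)\<^sub>j\<^sup>2\<close>, that is \<open>|A v|\<^sup>2\<close>. A zero row contributes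
  nothing to either side.
\<close>
lemma expected_row_project_le:
  fixes A :: "real^'n^'m"
  assumes "A \<noteq> 0" "v \<in> row_space A"
  shows "(\<Sum>j\<in>UNIV. (norm (row j A))\<^sup>2 / (frobenius_norm A)\<^sup>2 * (norm (row_project A j v))\<^sup>2)
    \<le> (1 - (sigma_min_pos A)\<^sup>2 / (frobenius_norm A)\<^sup>2) * (norm v)\<^sup>2"
proof -
  let ?F = "(frobenius_norm A)\<^sup>2"
  note F = frobenius_norm_pos[OF assms(1)]
  have "(norm (row j A))\<^sup>2 * (norm (row_project A j v))\<^sup>2 =
      (norm (row j A))\<^sup>2 * (norm v)\<^sup>2 - ((A *v v) $ j)\<^sup>2" for j
    by (cases "row j A = 0") (simp_all add: norm_row_project matrix_vector_mult_nth field_simps)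
  then have "(\<Sum>j\<in>UNIV. (norm (row j A))\<^sup>2 / ?F * (norm (row_project A j v))\<^sup>2) =
      (\<Sum>j\<in>UNIV. (norm (row j A))\<^sup>2 * (norm v)\<^sup>2 - ((A *v v) $ j)\<^sup>2) / ?F"
    by (simp add: sum_divide_distrib)
  also have "\<dots> = (?F * (norm v)\<^sup>2 - (norm (A *v v))\<^sup>2) / ?F"
    by (simp add: sum_subtractf frobenius_norm_rows sum_distrib_right power2_norm_eq_inner[of "A *v v"]
        inner_vec_def flip: power2_eq_square)
  also have "\<dots> \<le> (?F * (norm v)\<^sup>2 - (sigma_min_pos A)\<^sup>2 * (norm v)\<^sup>2) / ?F"
    using sigma_min_pos_bound[OF assms] F by (intro divide_right_mono) auto
  also have "\<dots> = (1 - (sigma_min_pos A)\<^sup>2 / ?F) * (norm v)\<^sup>2"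
    using F by (simp add: field_simps)
  finally show ?thesis .
qed

text \<open>
  The factor bounds an expected squared norm, for some unit vector.
\<close>
lemma contraction_factor_nonneg:
  fixes A :: "real^'n^'m"
  assumes "A \<noteq> 0"
  shows "0 \<le> 1 - (sigma_min_pos A)\<^sup>2 / (frobenius_norm A)\<^sup>2"
proof -
  obtain v where v: "v \<in> row_space A" "norm v = 1"
    using row_space_nontrivial[OF assms] .
  have "0 \<le> (\<Sum>j\<in>UNIV. (norm (row j A))\<^sup>2 / (frobenius_norm A)\<^sup>2 * (norm (row_project A j v))\<^sup>2)"
    by (intro sum_nonneg) simp
  also note expected_row_project_le[OF assms v(1)]
  finally show ?thesis using v(2) by simp
qed

section \<open>Expectations under independent sampling\<close>

text \<open>
  That a quantity depends only on the samples with index in \<open>S\<close> is expressed as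
  \<open>F (restrict y S) = F y\<close>, for \<open>F\<close> a function of the whole sample sequence.
\<close>
lemma restrict_invariant_mono:
  assumes "\<And>y. F (restrict y S) = F y" "S \<subseteq> T"
  shows "F (restrict y T) = F y"
  by (metis assms Int_absorb1 restrict_restrict)

context prob_space
begin

text \<open>
  Such a quantity takes finitely many values if \<open>S\<close> and the type of the samples are finite, and
  every function on the corresponding product space is measurable.
\<close>
lemma integrable_finitely_many_discrete:
  fixes Y :: "'t \<Rightarrow> 'a \<Rightarrow> 'm::finite" and f :: "('t \<Rightarrow> 'm) \<Rightarrow> real"
  assumes Y: "indep_vars (\<lambda>_. count_space UNIV) Y I"
    and S: "finite S" "S \<subseteq> I"
    and f: "\<And>y. f (restrict y S) = f y"
  shows "integrable M (\<lambda>\<omega>. f (\<lambda>t. Y t \<omega>))"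
proof -
  have PiM: "PiM S (\<lambda>_. count_space (UNIV :: 'm set)) = count_space (PiE S (\<lambda>_. UNIV))"
    using S(1) by (intro count_space_PiM_finite) auto
  have "(\<lambda>\<omega>. restrict (\<lambda>t. Y t \<omega>) S) \<in> M \<rightarrow>\<^sub>M count_space (PiE S (\<lambda>_. UNIV))"
    unfolding PiM[symmetric] using Y S(2)
    by (intro measurable_restrict) (auto simp: indep_vars_def)
  then have "(\<lambda>\<omega>. f (restrict (\<lambda>t. Y t \<omega>) S)) \<in> borel_measurable M"
    by (rule measurable_compose) simp
  then have meas: "(\<lambda>\<omega>. f (\<lambda>t. Y t \<omega>)) \<in> borel_measurable M"
    by (simp add: f)
  have fin: "finite (f ` PiE S (\<lambda>_. UNIV))"
    using S(1) by (intro finite_imageI finite_PiE) auto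
  have "f y \<in> f ` PiE S (\<lambda>_. UNIV)" for y
    by (metis f image_eqI restrict_PiE_iff UNIV_I)
  then have "norm (f y) \<le> Max (norm ` f ` PiE S (\<lambda>_. UNIV))" for y
    using fin by (intro Max_ge) auto
  then show ?thesis
    by (intro integrable_const_bound[OF _ meas]) auto
qed

text \<open>
  One sample can be averaged out with the others held fixed: split \<open>f\<close> according to the value
  \<open>j\<close> of the sample \<open>t\<close>, and factor the expectation of each product of the indicator of
  \<open>Y t = j\<close> and \<open>f j\<close>, which are independent.
\<close>
lemma expectation_independent_coordinate:
  fixes Y :: "'t \<Rightarrow> 'a \<Rightarrow> 'm::finite" and f :: "'m \<Rightarrow> ('t \<Rightarrow> 'm) \<Rightarrow> real"
  assumes Y: "indep_vars (\<lambda>_. count_space UNIV) Y I"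
    and S: "finite S" "S \<subseteq> I" and t: "t \<in> I" "t \<notin> S"
    and f: "\<And>j y. f j (restrict y S) = f j y"
  shows "expectation (\<lambda>\<omega>. f (Y t \<omega>) (\<lambda>s. Y s \<omega>)) =
    expectation (\<lambda>\<omega>. \<Sum>j\<in>UNIV. prob {\<omega>' \<in> space M. Y t \<omega>' = j} * f j (\<lambda>s. Y s \<omega>))"
proof -
  let ?C = "\<lambda>_. count_space (UNIV :: 'm set)"
  let ?ind = "\<lambda>j \<omega>. if Y t \<omega> = j then 1 else 0 :: real"
  have PiM: "PiM U ?C = count_space (PiE U (\<lambda>_. UNIV))" if "finite U" for U :: "'t set"
    using that by (intro count_space_PiM_finite) auto
  have Yt: "Y t \<in> M \<rightarrow>\<^sub>M count_space UNIV"
    using Y t by (auto simp: indep_vars_def)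
  have ev: "{\<omega> \<in> space M. Y t \<omega> = j} \<in> events" for j
    using Yt by measurable
  have intf: "integrable M (\<lambda>\<omega>. f j (\<lambda>s. Y s \<omega>))" for j
    using integrable_finitely_many_discrete[OF Y S, of "f j"] f by simp
  have inti: "integrable M (?ind j)" for j
    by (rule integrable_const_bound[of _ 1]) (use Yt in measurable)
  have expi: "expectation (?ind j) = prob {\<omega> \<in> space M. Y t \<omega> = j}" for j
  proof -
    have "expectation (?ind j) = expectation (indicator {\<omega> \<in> space M. Y t \<omega> = j})"
      by (intro Bochner_Integration.integral_cong) (auto simp: indicator_def)
    then show ?thesis using ev by simp
  qed
  have ind: "indep_var borel (?ind j) borel (\<lambda>\<omega>. f j (\<lambda>s. Y s \<omega>))" for j
  proof -
    have "indep_var (PiM {t} ?C) (\<lambda>\<omega>. restrict (\<lambda>s. Y s \<omega>) {t})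
        (PiM S ?C) (\<lambda>\<omega>. restrict (\<lambda>s. Y s \<omega>) S)"
      using t S by (intro indep_var_restrict[OF Y]) auto
    then have "indep_var borel ((\<lambda>h. if h t = j then 1 else 0) \<circ> (\<lambda>\<omega>. restrict (\<lambda>s. Y s \<omega>) {t}))
        borel (f j \<circ> (\<lambda>\<omega>. restrict (\<lambda>s. Y s \<omega>) S))"
      by (rule indep_var_compose) (use PiM[of "{t}"] PiM[OF S(1)] in simp_all)
    then show ?thesis
      by (simp add: o_def f)
  qed
  note mult = indep_var_lebesgue_integral[OF ind inti intf] indep_var_integrable[OF ind inti intf]
  have "expectation (\<lambda>\<omega>. f (Y t \<omega>) (\<lambda>s. Y s \<omega>)) =
      expectation (\<lambda>\<omega>. \<Sum>j\<in>UNIV. ?ind j \<omega> * f j (\<lambda>s. Y s \<omega>))"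
    by (intro Bochner_Integration.integral_cong) (simp_all add: if_distrib[of "\<lambda>c. c * _"] cong: if_cong)
  also have "\<dots> = (\<Sum>j\<in>UNIV. prob {\<omega>' \<in> space M. Y t \<omega>' = j} * expectation (\<lambda>\<omega>. f j (\<lambda>s. Y s \<omega>)))"
    by (simp add: Bochner_Integration.integral_sum mult expi)
  also have "\<dots> = expectation (\<lambda>\<omega>. \<Sum>j\<in>UNIV. prob {\<omega>' \<in> space M. Y t \<omega>' = j} * f j (\<lambda>s. Y s \<omega>))"
    using intf by (simp add: Bochner_Integration.integral_sum)
  finally show ?thesis .
qed

text \<open>
  Induction over the list of single-row steps. After the step with index \<open>t\<close>, the vector depends
  on the samples with index in \<open>insert t S\<close> and is still in the row space, and so is a valid
  starting point for the remaining steps; hence \<open>S\<close> and \<open>F\<close> are generalized.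
\<close>
lemma expected_fold_row_project_le:
  fixes A :: "real^'n^'m" and Y :: "'t \<Rightarrow> 'a \<Rightarrow> 'm" and F :: "('t \<Rightarrow> 'm) \<Rightarrow> real^'n"
  assumes "A \<noteq> 0"
    and Y: "indep_vars (\<lambda>_. count_space UNIV) Y I"
    and sampling: "\<And>t j. t \<in> I \<Longrightarrow> prob {\<omega> \<in> space M. Y t \<omega> = j} =
      (norm (row j A))\<^sup>2 / (frobenius_norm A)\<^sup>2"
    and "finite S" "S \<subseteq> I" "distinct ts" "set ts \<subseteq> I - S"
    and "\<And>y. F (restrict y S) = F y" "\<And>y. F y \<in> row_space A"
  shows "expectation (\<lambda>\<omega>. (norm (fold (\<lambda>t. row_project A (Y t \<omega>)) ts (F (\<lambda>s. Y s \<omega>))))\<^sup>2)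
    \<le> (1 - (sigma_min_pos A)\<^sup>2 / (frobenius_norm A)\<^sup>2) ^ length ts *
      expectation (\<lambda>\<omega>. (norm (F (\<lambda>s. Y s \<omega>)))\<^sup>2)"
  using assms(4-)
proof (induction ts arbitrary: S F)
  case (Cons t ts)
  let ?c = "1 - (sigma_min_pos A)\<^sup>2 / (frobenius_norm A)\<^sup>2"
  let ?p = "\<lambda>j. (norm (row j A))\<^sup>2 / (frobenius_norm A)\<^sup>2"
  let ?F' = "\<lambda>y. row_project A (y t) (F y)"
  have t: "t \<in> I" "t \<notin> S" using Cons.prems by auto
  note S = Cons.prems(1,2)
  have "F (restrict y (insert t S)) = F y" for y
    using Cons.prems(5) by (rule restrict_invariant_mono) auto
  then have F': "?F' (restrict y (insert t S)) = ?F' y" for y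
    by simp
  have "expectation (\<lambda>\<omega>. (norm (?F' (\<lambda>s. Y s \<omega>)))\<^sup>2) =
      expectation (\<lambda>\<omega>. \<Sum>j\<in>UNIV. ?p j * (norm (row_project A j (F (\<lambda>s. Y s \<omega>))))\<^sup>2)"
    using expectation_independent_coordinate[OF Y S t,
        of "\<lambda>j y. (norm (row_project A j (F y)))\<^sup>2"] Cons.prems(5) sampling[OF t(1)]
    by simp
  also have "\<dots> \<le> expectation (\<lambda>\<omega>. ?c * (norm (F (\<lambda>s. Y s \<omega>)))\<^sup>2)"
  proof (rule integral_mono)
    show "integrable M (\<lambda>\<omega>. \<Sum>j\<in>UNIV. ?p j * (norm (row_project A j (F (\<lambda>s. Y s \<omega>))))\<^sup>2)"
      by (intro integrable_finitely_many_discrete[OF Y S,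
        of "\<lambda>y. \<Sum>j\<in>UNIV. ?p j * (norm (row_project A j (F y)))\<^sup>2"]) (simp only: Cons.prems(5))
    show "integrable M (\<lambda>\<omega>. ?c * (norm (F (\<lambda>s. Y s \<omega>)))\<^sup>2)"
      by (intro integrable_finitely_many_discrete[OF Y S,
        of "\<lambda>y. ?c * (norm (F y))\<^sup>2"]) (simp only: Cons.prems(5))
  qed (rule expected_row_project_le[OF \<open>A \<noteq> 0\<close> Cons.prems(6)])
  finally have step: "expectation (\<lambda>\<omega>. (norm (?F' (\<lambda>s. Y s \<omega>)))\<^sup>2)
      \<le> ?c * expectation (\<lambda>\<omega>. (norm (F (\<lambda>s. Y s \<omega>)))\<^sup>2)"
    by simp
  have "expectation (\<lambda>\<omega>. (norm (fold (\<lambda>t. row_project A (Y t \<omega>)) ts (?F' (\<lambda>s. Y s \<omega>))))\<^sup>2)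
      \<le> ?c ^ length ts * expectation (\<lambda>\<omega>. (norm (?F' (\<lambda>s. Y s \<omega>)))\<^sup>2)"
    by (rule Cons.IH[of "insert t S" ?F', OF _ _ _ _ F' row_project_in_row_space[OF Cons.prems(6)]])
      (use Cons.prems(1-4) in auto)
  also have "\<dots> \<le> ?c ^ length ts * (?c * expectation (\<lambda>\<omega>. (norm (F (\<lambda>s. Y s \<omega>)))\<^sup>2))"
    using contraction_factor_nonneg[OF \<open>A \<noteq> 0\<close>] by (intro mult_left_mono step) simp
  finally show ?case by (simp add: mult.assoc mult.left_commute)
qed simp

end

section \<open>Convergence of the randomized block Kaczmarz method\<close>

text \<open>
  The variational inequality for the closest point of a convex set, applied to \<open>xs + w\<close> and
  \<open>xs - w\<close> for \<open>w\<close> in the kernel of \<open>A\<close>.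
\<close>
lemma closest_solution_error_in_row_space:
  fixes A :: "real^'n^'m"
  assumes "\<exists>x. A *v x = b" and xs: "xs = closest_point {x. A *v x = b} x0"
  shows "A *v xs = b" "x0 - xs \<in> row_space A"
proof -
  let ?S = "{x. A *v x = b}"
  have closed: "closed ?S"
    by (intro closed_Collect_eq continuous_intros linear_continuous_on
        linear_conv_bounded_linear[THEN iffD1] matrix_vector_mul_linear)
  have convex: "convex ?S"
    by (auto simp: convex_def matrix_vector_right_distrib matrix_vector_mult_scaleR
        simp flip: scaleR_add_left)
  have "xs \<in> ?S"
    unfolding xs using closed assms(1) by (intro closest_point_in_set) auto
  then show "A *v xs = b" by simp
  have le: "(x0 - xs) \<bullet> w \<le> 0" if "A *v w = 0" for w
    using closest_point_dot[OF convex closed, of "xs + w" x0] that \<open>A *v xs = b\<close>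
    by (simp add: matrix_vector_right_distrib flip: xs)
  have "(x0 - xs) \<bullet> w = 0" if "A *v w = 0" for w
    using le[OF that] le[of "- w"] that matrix_vector_mult_scaleR[of A "- 1" w] by simp
  then show "x0 - xs \<in> row_space A" by (simp add: row_space_def)
qed

lemma block_kaczmarz_cong:
  "(\<And>t. t < k \<Longrightarrow> J t = J' t) \<Longrightarrow> block_kaczmarz A b x0 J k = block_kaczmarz A b x0 J' k"
  by (induction k) simp_all

theorem proposition1p9:
  fixes A :: "real^'n^'m" and b :: "real^'m" and x0 xs :: "real^'n"
    and M :: "'a measure" and J :: "nat \<Rightarrow> 'l::finite \<Rightarrow> 'a \<Rightarrow> 'm"
  assumes "A \<noteq> 0"
    and consistent: "\<exists>x. A *v x = b"
    and xs: "xs = closest_point {x. A *v x = b} x0"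
    and "prob_space M"
    and indep: "prob_space.indep_vars M (\<lambda>_. count_space UNIV) (\<lambda>(k, i). J k i) UNIV"
    and sampling: "\<And>k i j. measure M {\<omega> \<in> space M. J k i \<omega> = j} =
                     (norm (row j A))\<^sup>2 / (frobenius_norm A)\<^sup>2"
  shows "\<forall>k. prob_space.expectation M
               (\<lambda>\<omega>. (norm (block_kaczmarz A b x0 (\<lambda>t i. J t i \<omega>) k - xs))\<^sup>2)
             \<le> (1 - (sigma_min_pos A)\<^sup>2 / (frobenius_norm A)\<^sup>2) ^ (CARD('l) * k)
                * (norm (x0 - xs))\<^sup>2"
proof -
  interpret prob_space M by fact
  let ?c = "1 - (sigma_min_pos A)\<^sup>2 / (frobenius_norm A)\<^sup>2"
  define Y where "Y = (\<lambda>(k, i). J k i)"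
  \<comment> \<open>The error after \<open>k\<close> steps as a function of the whole sample sequence; it depends only on
    the samples with index in \<open>S k\<close>.\<close>
  define e where "e k y = block_kaczmarz A b x0 (\<lambda>t i. y (t, i)) k - xs"
    for k and y :: "nat \<times> 'l \<Rightarrow> 'm"
  define S where "S k = {..<k} \<times> (UNIV :: 'l set)" for k :: nat
  note sol = closest_solution_error_in_row_space[OF consistent xs]
  have Y: "indep_vars (\<lambda>_. count_space UNIV) Y UNIV"
    using indep unfolding Y_def .
  have p: "prob {\<omega> \<in> space M. Y t \<omega> = j} = (norm (row j A))\<^sup>2 / (frobenius_norm A)\<^sup>2" for t j
    using sampling[of "fst t" "snd t" j] by (simp add: Y_def split_beta)
  have S: "finite (S k)" for k by (simp add: S_def)
  have e_Suc: "e (Suc k) y = block_project A (\<lambda>i. y (k, i)) (e k y)" for k y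
    unfolding e_def by (rule block_kaczmarz_error_Suc[OF sol(1)])
  have e_row: "e k y \<in> row_space A" for k y
  proof (induction k)
    case 0
    then show ?case using sol(2) by (simp add: e_def)
  qed (simp add: e_Suc block_project_in_row_space)
  have e_restrict: "e k (restrict y (S k)) = e k y" for k y
    unfolding e_def by (intro arg_cong2[of _ _ _ _ minus] refl block_kaczmarz_cong) (auto simp: S_def)
  \<comment> \<open>An arbitrary enumeration of the positions in a block, along which a block step is compared
    with single-row steps.\<close>
  obtain L :: "'l list" where L: "set L = UNIV" "distinct L"
    using finite_distinct_list[OF finite[of UNIV]] by blast
  have len: "length L = CARD('l)"
    using distinct_card[OF L(2)] L(1) by simp
  have "expectation (\<lambda>\<omega>. (norm (e k (\<lambda>s. Y s \<omega>)))\<^sup>2) \<le> ?c ^ (CARD('l) * k) * (norm (x0 - xs))\<^sup>2" for k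
  proof (induction k)
    case 0
    then show ?case by (simp add: e_def prob_space)
  next
    case (Suc k)
    let ?ts = "map (Pair k) L"
    have fold_eq: "fold (\<lambda>t. row_project A (y t)) ?ts v = fold (\<lambda>i. row_project A (y (k, i))) L v" for y v
      by (simp add: fold_map o_def)
    have "expectation (\<lambda>\<omega>. (norm (e (Suc k) (\<lambda>s. Y s \<omega>)))\<^sup>2)
        \<le> expectation (\<lambda>\<omega>. (norm (fold (\<lambda>t. row_project A (Y t \<omega>)) ?ts (e k (\<lambda>s. Y s \<omega>))))\<^sup>2)"
    proof (rule integral_mono)
      show "integrable M (\<lambda>\<omega>. (norm (e (Suc k) (\<lambda>s. Y s \<omega>)))\<^sup>2)"
        by (intro integrable_finitely_many_discrete[OF Y S, of "Suc k" "\<lambda>y. (norm (e (Suc k) y))\<^sup>2"])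
          (simp_all add: e_restrict)
      have "e k (restrict y (S (Suc k))) = e k y" for y
        using e_restrict[of k] by (rule restrict_invariant_mono) (auto simp: S_def)
      then show "integrable M (\<lambda>\<omega>. (norm (fold (\<lambda>t. row_project A (Y t \<omega>)) ?ts (e k (\<lambda>s. Y s \<omega>))))\<^sup>2)"
        by (intro integrable_finitely_many_discrete[OF Y S, of "Suc k"
            "\<lambda>y. (norm (fold (\<lambda>t. row_project A (y t)) ?ts (e k y)))\<^sup>2"])
          (simp_all add: fold_eq, simp add: S_def)
    qed (simp add: e_Suc fold_eq power_mono norm_block_project_le_fold)
    also have "\<dots> \<le> ?c ^ length ?ts * expectation (\<lambda>\<omega>. (norm (e k (\<lambda>s. Y s \<omega>)))\<^sup>2)"
      using L by (intro expected_fold_row_project_le[OF \<open>A \<noteq> 0\<close> Y p S[of k]] e_restrict e_row)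
        (auto simp: distinct_map inj_on_def S_def)
    also have "\<dots> \<le> ?c ^ length ?ts * (?c ^ (CARD('l) * k) * (norm (x0 - xs))\<^sup>2)"
      using contraction_factor_nonneg[OF \<open>A \<noteq> 0\<close>] by (intro mult_left_mono Suc.IH) simp
    finally show ?case by (simp add: len power_add mult.assoc)
  qed
  then show ?thesis by (simp add: e_def Y_def)
qed

end
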